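(* Let $\Gamma$ be an infinite, finitely generated group equipped with a word-length, and let $s\ge 0$. If $\Gamma$ satisfies $(\mathrm{RD}^s_\bullet)$, then $s\geq \frac12$.
   Context: A finitely generated group $\Gamma$ is equipped with the word-length $|\cdot|$ associated with some finite generating set (the choice is irrelevant). $\mathbb{C}\Gamma$ is the complex group algebra; for $a=\sum a_g g\in\mathbb{C}\Gamma$ put $\|a\|_2=\big(\sum|a_g|^2\big)^{1/2}$, and let $\|a\|$ be the operator norm of $a$ acting on $\ell^2\Gamma$ by the (left) regular representation, i.e. of the convolution operator $\xi\mapsto a\xi$. For $s\ge0$, $\Gamma$ satisfies $(\mathrm{RD}^s_\bullet)$ if there is $C\ge0$ such that, for all integers $n\ge0$, one has $\|a\|\le C(1+n)^s\|a\|_2$ whenever $a\in\mathbb{C}\Gamma$ is supported on elements of length at most $n$. *)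

theory Defs
  imports "HOL-Algebra.Generated_Groups" "HOL-Analysis.Analysis"
begin

text \<open>The least length of an expression of an element as a product of generators
  and inverses of generators. When \<open>S\<close> generates \<open>G\<close>, the set of such
  lengths is nonempty for every element of \<open>G\<close> (lemma \<open>word_exists\<close>).\<close>

definition word_length :: "('a, 'b) monoid_scheme \<Rightarrow> 'a set \<Rightarrow> 'a \<Rightarrow> nat" where
  "word_length G S g =
     (LEAST n. \<exists>ws. length ws = n \<and> set ws \<subseteq> S \<union> m_inv G ` S \<and> foldr (\<otimes>\<^bsub>G\<^esub>) ws \<one>\<^bsub>G\<^esub> = g)"

text \<open>Elements of the complex group algebra and of the Hilbert space of square-summable
  functions are represented as functions that vanish outside the carrier; the first is then
  a subset of the second.\<close>

definition group_algebra :: "('a, 'b) monoid_scheme \<Rightarrow> ('a \<Rightarrow> complex) set" where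
  "group_algebra G = {a. finite {g. a g \<noteq> 0} \<and> {g. a g \<noteq> 0} \<subseteq> carrier G}"

definition ell2 :: "('a, 'b) monoid_scheme \<Rightarrow> ('a \<Rightarrow> complex) set" where
  "ell2 G = {\<xi>. {g. \<xi> g \<noteq> 0} \<subseteq> carrier G \<and> (\<lambda>g. (cmod (\<xi> g))\<^sup>2) summable_on carrier G}"

definition ell2_norm :: "('a, 'b) monoid_scheme \<Rightarrow> ('a \<Rightarrow> complex) \<Rightarrow> real" where
  "ell2_norm G \<xi> = sqrt (\<Sum>\<^sub>\<infinity>g\<in>carrier G. (cmod (\<xi> g))\<^sup>2)"

definition convolution ::
  "('a, 'b) monoid_scheme \<Rightarrow> ('a \<Rightarrow> complex) \<Rightarrow> ('a \<Rightarrow> complex) \<Rightarrow> 'a \<Rightarrow> complex" where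
  "convolution G a \<xi> g =
     (if g \<in> carrier G then \<Sum>h | a h \<noteq> 0. a h * \<xi> (m_inv G h \<otimes>\<^bsub>G\<^esub> g) else 0)"

text \<open>The supremum is over a nonempty set of reals, which is bounded above for every \<open>a\<close> in
  the group algebra (lemma \<open>convolution_bounded\<close>).\<close>

definition operator_norm :: "('a, 'b) monoid_scheme \<Rightarrow> ('a \<Rightarrow> complex) \<Rightarrow> real" where
  "operator_norm G a = (SUP \<xi>\<in>{\<xi> \<in> ell2 G. ell2_norm G \<xi> \<le> 1}. ell2_norm G (convolution G a \<xi>))"

definition RD_bullet :: "('a, 'b) monoid_scheme \<Rightarrow> 'a set \<Rightarrow> real \<Rightarrow> bool" where
  "RD_bullet G S s \<longleftrightarrow>
     (\<exists>C\<ge>0. \<forall>n::nat. \<forall>a\<in>group_algebra G. (\<forall>g. a g \<noteq> 0 \<longrightarrow> word_length G S g \<le> n) \<longrightarrow>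
        operator_norm G a \<le> C * (1 + real n) powr s * ell2_norm G a)"

lemma word_exists:
  assumes "group G" "S \<subseteq> carrier G" "g \<in> generate G S"
  shows "\<exists>ws. set ws \<subseteq> S \<union> m_inv G ` S \<and> foldr (\<otimes>\<^bsub>G\<^esub>) ws \<one>\<^bsub>G\<^esub> = g"
proof -
  interpret group G by fact
  have S: "S \<union> m_inv G ` S \<subseteq> carrier G" using assms(2) by auto
  have closed: "foldr (\<otimes>\<^bsub>G\<^esub>) ws \<one>\<^bsub>G\<^esub> \<in> carrier G" if "set ws \<subseteq> carrier G" for ws
    using that by (induction ws) auto
  have app: "foldr (\<otimes>\<^bsub>G\<^esub>) (us @ vs) \<one>\<^bsub>G\<^esub> = foldr (\<otimes>\<^bsub>G\<^esub>) us \<one>\<^bsub>G\<^esub> \<otimes>\<^bsub>G\<^esub> foldr (\<otimes>\<^bsub>G\<^esub>) vs \<one>\<^bsub>G\<^esub>"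
    if "set us \<subseteq> carrier G" "set vs \<subseteq> carrier G" for us vs
    using that(1) by (induction us) (use that(2) closed in \<open>auto simp: m_assoc\<close>)
  from assms(3) show ?thesis
  proof (induction rule: generate.induct)
    case one
    show ?case by (rule exI[of _ "[]"]) auto
  next
    case (incl h)
    then show ?case using S by (intro exI[of _ "[h]"]) auto
  next
    case (inv h)
    then show ?case using S by (intro exI[of _ "[m_inv G h]"]) auto
  next
    case (eng h1 h2)
    then obtain us vs where uv: "set us \<subseteq> S \<union> m_inv G ` S" "foldr (\<otimes>\<^bsub>G\<^esub>) us \<one>\<^bsub>G\<^esub> = h1"
      "set vs \<subseteq> S \<union> m_inv G ` S" "foldr (\<otimes>\<^bsub>G\<^esub>) vs \<one>\<^bsub>G\<^esub> = h2" by blast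
    have "foldr (\<otimes>\<^bsub>G\<^esub>) (us @ vs) \<one>\<^bsub>G\<^esub> = h1 \<otimes>\<^bsub>G\<^esub> h2"
      using app[of us vs] uv S by blast
    then show ?case using uv by (intro exI[of _ "us @ vs"]) auto
  qed
qed

lemma convolution_bounded:
  assumes "group G" "a \<in> group_algebra G"
  shows "\<xi> \<in> ell2 G \<Longrightarrow> convolution G a \<xi> \<in> ell2 G"
    and "bdd_above ((\<lambda>\<xi>. ell2_norm G (convolution G a \<xi>)) ` {\<xi> \<in> ell2 G. ell2_norm G \<xi> \<le> 1})"
proof -
  interpret group G by fact
  define A where "A = {h. a h \<noteq> 0}"
  have fin: "finite A" and AG: "A \<subseteq> carrier G"
    using assms(2) by (auto simp: group_algebra_def A_def)
  define N where "N = (\<Sum>h\<in>A. (cmod (a h))\<^sup>2)"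
  have N0: "N \<ge> 0" unfolding N_def by (simp add: sum_nonneg)
  have bij: "bij_betw (\<lambda>g. m_inv G h \<otimes>\<^bsub>G\<^esub> g) (carrier G) (carrier G)" if "h \<in> A" for h
    using that AG
    by (intro bij_betw_byWitness[where f' = "\<lambda>g. h \<otimes>\<^bsub>G\<^esub> g"]) (auto simp: m_assoc[symmetric])
  have key: "(\<lambda>g. (cmod (convolution G a \<xi> g))\<^sup>2) summable_on carrier G \<and>
      (\<Sum>\<^sub>\<infinity>g\<in>carrier G. (cmod (convolution G a \<xi> g))\<^sup>2)
        \<le> N * (real (card A) * (\<Sum>\<^sub>\<infinity>g\<in>carrier G. (cmod (\<xi> g))\<^sup>2))"
    if \<xi>: "\<xi> \<in> ell2 G" for \<xi>
  proof -
    let ?f = "\<lambda>g. (cmod (\<xi> g))\<^sup>2"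
    have sm: "?f summable_on carrier G" using \<xi> by (simp add: ell2_def)
    have hs: "((\<lambda>g. ?f (m_inv G h \<otimes>\<^bsub>G\<^esub> g)) has_sum infsum ?f (carrier G)) (carrier G)"
      if "h \<in> A" for h
      using has_sum_reindex_bij_betw[OF bij[OF that], of ?f] has_sum_infsum[OF sm] by simp
    have "((\<lambda>g. \<Sum>h\<in>A. ?f (m_inv G h \<otimes>\<^bsub>G\<^esub> g)) has_sum (\<Sum>h\<in>A. infsum ?f (carrier G))) (carrier G)"
      using fin hs by (induction A rule: finite_induct) (auto intro!: has_sum_add simp del: sum_constant)
    then have H: "((\<lambda>g. N * (\<Sum>h\<in>A. ?f (m_inv G h \<otimes>\<^bsub>G\<^esub> g))) has_sum
        (N * (real (card A) * infsum ?f (carrier G)))) (carrier G)"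
      by (intro has_sum_cmult_right) simp
    have pt: "(cmod (convolution G a \<xi> g))\<^sup>2 \<le> N * (\<Sum>h\<in>A. ?f (m_inv G h \<otimes>\<^bsub>G\<^esub> g))"
      if "g \<in> carrier G" for g
    proof -
      have "cmod (convolution G a \<xi> g) \<le> (\<Sum>h\<in>A. cmod (a h) * cmod (\<xi> (m_inv G h \<otimes>\<^bsub>G\<^esub> g)))"
        using that norm_sum[of "\<lambda>h. a h * \<xi> (m_inv G h \<otimes>\<^bsub>G\<^esub> g)" A]
        by (simp add: convolution_def A_def norm_mult)
      then have "(cmod (convolution G a \<xi> g))\<^sup>2
          \<le> (\<Sum>h\<in>A. cmod (a h) * cmod (\<xi> (m_inv G h \<otimes>\<^bsub>G\<^esub> g)))\<^sup>2"
        by (intro power_mono) auto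
      also have "\<dots> \<le> N * (\<Sum>h\<in>A. ?f (m_inv G h \<otimes>\<^bsub>G\<^esub> g))"
        unfolding N_def by (rule Cauchy_Schwarz_ineq_sum)
      finally show ?thesis .
    qed
    have sm': "(\<lambda>g. (cmod (convolution G a \<xi> g))\<^sup>2) summable_on carrier G"
      by (rule summable_on_comparison_test[OF has_sum_imp_summable[OF H]]) (use pt in auto)
    have "infsum (\<lambda>g. (cmod (convolution G a \<xi> g))\<^sup>2) (carrier G)
        \<le> N * (real (card A) * infsum ?f (carrier G))"
      by (rule has_sum_mono[OF has_sum_infsum[OF sm'] H]) (use pt in auto)
    with sm' show ?thesis by simp
  qed
  show "convolution G a \<xi> \<in> ell2 G" if "\<xi> \<in> ell2 G"
    using key[OF that] by (auto simp: ell2_def convolution_def)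
  show "bdd_above ((\<lambda>\<xi>. ell2_norm G (convolution G a \<xi>)) ` {\<xi> \<in> ell2 G. ell2_norm G \<xi> \<le> 1})"
  proof (rule bdd_aboveI2)
    fix \<xi> assume \<xi>: "\<xi> \<in> {\<xi> \<in> ell2 G. ell2_norm G \<xi> \<le> 1}"
    then have "(\<Sum>\<^sub>\<infinity>g\<in>carrier G. (cmod (\<xi> g))\<^sup>2) \<le> 1" by (simp add: ell2_norm_def)
    then have "N * (real (card A) * (\<Sum>\<^sub>\<infinity>g\<in>carrier G. (cmod (\<xi> g))\<^sup>2)) \<le> N * (real (card A) * 1)"
      using N0 by (intro mult_left_mono) auto
    with key[of \<xi>] \<xi> show "ell2_norm G (convolution G a \<xi>) \<le> sqrt (N * (real (card A) * 1))"
      unfolding ell2_norm_def by (intro real_sqrt_le_mono) auto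
  qed
qed

end

theory Submission
  imports Defs "HOL-Computational_Algebra.Fundamental_Theorem_Algebra"
    "HOL-Real_Asymp.Real_Asymp"
begin

text \<open>
For an infinite amenable group the claim follows from the growth of balls, and for a group with an
element of infinite order from its powers. The argument below treats all groups at once by applying
the hypothesis only to polynomials in one self-adjoint element \<open>x\<close>, the sum of the generators and
their inverses. A polynomial \<open>p(x)\<close> of degree at most \<open>n\<close> is supported on elements of length at most
\<open>n\<close>, so rapid decay bounds its operator norm by \<open>C * (1 + n) powr s\<close> times its 2-norm.

Let \<open>\<mu>\<close> be the spectral measure of \<open>x\<close> at the identity. The operator norm of \<open>p(x)\<close> is the supremum
of \<open>\<bar>p\<bar>\<close> on the spectrum, and the 2-norm of \<open>p(x)\<close> is the norm of \<open>p\<close> in the square-integrable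
functions for \<open>\<mu>\<close>. Let \<open>p\<^sub>0, \<dots>, p\<^sub>n\<close> be the orthonormal polynomials of \<open>\<mu>\<close>; there are \<open>n + 1\<close> of them
because \<open>\<mu>\<close> has infinite support when the group is infinite. Evaluation at a point \<open>t\<close> of the spectrum,
applied to the polynomial \<open>\<Sum>i\<le>n. p\<^sub>i(t) * p\<^sub>i\<close>, shows that rapid decay forces
\<open>(\<Sum>i\<le>n. (p\<^sub>i(t))\<^sup>2) \<le> C\<^sup>2 * (1 + n) powr (2 * s)\<close>. The left-hand side has integral \<open>n + 1\<close> against the
probability measure \<open>\<mu>\<close>, so that \<open>n + 1 \<le> C\<^sup>2 * (1 + n) powr (2 * s)\<close> for all \<open>n\<close>, which is possible
only when \<open>s \<ge> 1 / 2\<close>.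

The spectral theorem is avoided by working with the functional \<open>p \<mapsto> \<integral> p d\<mu>\<close> alone, which sends
\<open>p\<close> to the coefficient of \<open>p(x)\<close> at the identity. What remains is a statement about a positive
functional \<open>L\<close> on real polynomials (lemma \<open>dimension_bound\<close>), in which the spectrum is replaced by
approximate eigenvectors among the polynomials themselves (lemmas \<open>approx_null_root\<close> and
\<open>evaluation_bounded\<close>). On the side of the group, \<open>canonical_trace_positive\<close> and
\<open>ell2_norm_convolution_le\<close> make this statement applicable.
\<close>

section \<open>Positive functionals on real polynomials\<close>

lemma poly_extI:
  fixes p q :: "real poly"
  shows "(\<And>x. poly p x = poly q x) \<Longrightarrow> p = q"
  by (simp add: fun_eq_iff flip: poly_eq_poly_eq_iff)

text \<open>
The functional \<open>L\<close> plays the role of integration against a measure of infinite support on the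
real line. Accordingly \<open>(p, q) \<mapsto> L (p * q)\<close> is an inner product on polynomials, and multiplication
by the indeterminate is a symmetric operator for it.
\<close>

locale positive_functional =
  fixes L :: "real poly \<Rightarrow> real"
  assumes add: "L (p + q) = L p + L q"
    and smult: "L (smult c p) = c * L p"
    and pos: "p \<noteq> 0 \<Longrightarrow> L (p\<^sup>2) > 0"
begin

lemma zero [simp]: "L 0 = 0"
  using smult[of 0 0] by simp

lemma diff: "L (p - q) = L p - L q"
  using add[of "p - q" q] by simp

lemma sum: "L (sum f A) = (\<Sum>i\<in>A. L (f i))"
  by (induction A rule: infinite_finite_induct) (auto simp: add)

lemma nonneg: "L (p\<^sup>2) \<ge> 0"
  using pos[of p] by (cases "p = 0") auto

text \<open>
Gram-Schmidt applied to the monomials, in increasing degree. Keeping the degrees exact is what makes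
each new monomial independent of the polynomials already built.
\<close>

lemma orthonormal_polynomials:
  "\<exists>P. (\<forall>i<m. degree (P i) = i) \<and> (\<forall>i<m. \<forall>j<m. L (P i * P j) = (if i = j then 1 else 0))"
proof (induction m)
  case 0
  show ?case by simp
next
  case (Suc m)
  then obtain P where deg: "\<And>i. i < m \<Longrightarrow> degree (P i) = i"
    and orth: "\<And>i j. i < m \<Longrightarrow> j < m \<Longrightarrow> L (P i * P j) = (if i = j then 1 else 0)" by blast
  define v where "v = (\<Sum>i<m. smult (L (monom 1 m * P i)) (P i))"
  define u where "u = monom 1 m - v"
  have "coeff v k = 0" if "k \<ge> m" for k
    unfolding v_def coeff_sum using deg that by (auto intro!: sum.neutral coeff_eq_0)
  then have cu: "coeff u k = (if k = m then 1 else 0)" if "k \<ge> m" for k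
    using that by (simp add: u_def)
  have "degree u = m"
    using cu by (intro antisym degree_le le_degree) auto
  have "u \<noteq> 0" using cu[of m] by auto
  have perp: "L (u * P j) = 0" if "j < m" for j
  proof -
    have "L (v * P j) = (\<Sum>i<m. L (monom 1 m * P i) * L (P i * P j))"
      by (simp add: v_def sum_distrib_right sum smult)
    also have "\<dots> = (\<Sum>i<m. if i = j then L (monom 1 m * P j) else 0)"
      using orth that by (intro sum.cong) auto
    finally show ?thesis using that by (simp add: u_def left_diff_distrib diff)
  qed
  define c where "c = 1 / sqrt (L (u\<^sup>2))"
  have "L (u\<^sup>2) > 0" using pos \<open>u \<noteq> 0\<close> .
  then have c: "c \<noteq> 0" "c * c * L (u\<^sup>2) = 1" by (auto simp: c_def)
  have uu: "L (smult c u * smult c u) = 1"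
    using c(2) by (simp add: smult power2_eq_square mult.assoc)
  show ?case
  proof (intro exI[of _ "P(m := smult c u)"] conjI allI impI)
    show "degree ((P(m := smult c u)) i) = i" if "i < Suc m" for i
      using that deg c(1) \<open>degree u = m\<close> by auto
    show "L ((P(m := smult c u)) i * (P(m := smult c u)) j) = (if i = j then 1 else 0)"
      if "i < Suc m" "j < Suc m" for i j
    proof (cases "i = m \<and> j = m")
      case True
      then show ?thesis using uu by simp
    next
      case False
      then show ?thesis
        using that orth perp[of i] perp[of j] by (auto simp: smult mult.commute)
    qed
  qed
qed

text \<open>
When \<open>L\<close> is integration, \<open>f\<close> is approximately null when the operator of multiplication by
\<open>f\<close> on the square-integrable functions is not bounded below. For \<open>f = [:- t, 1:]\<close> this says that
\<open>t\<close> lies in the spectrum of multiplication by the indeterminate.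
\<close>

definition approx_null :: "real poly \<Rightarrow> bool" where
  "approx_null f \<longleftrightarrow> (\<forall>\<epsilon>>0. \<exists>r. r \<noteq> 0 \<and> L ((f * r)\<^sup>2) \<le> \<epsilon> * L (r\<^sup>2))"

text \<open>
A composition of operators that are bounded below is bounded below.
\<close>

lemma approx_null_mult:
  assumes "approx_null (f * g)"
  shows "approx_null f \<or> approx_null g"
proof (rule ccontr)
  assume "\<not> ?thesis"
  then obtain a b where a: "a > 0" "\<And>r. r \<noteq> 0 \<Longrightarrow> L ((f * r)\<^sup>2) > a * L (r\<^sup>2)"
    and b: "b > 0" "\<And>r. r \<noteq> 0 \<Longrightarrow> L ((g * r)\<^sup>2) > b * L (r\<^sup>2)"
    unfolding approx_null_def by (meson not_le)
  have "a * b > 0" using a b by simp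
  then obtain r where r: "r \<noteq> 0" "L ((f * g * r)\<^sup>2) \<le> a * b * L (r\<^sup>2)"
    using assms unfolding approx_null_def by blast
  have "g * r \<noteq> 0" using b(2)[OF r(1)] pos[OF r(1)] b(1) by (auto simp: mult_less_0_iff)
  have "a * (b * L (r\<^sup>2)) \<le> a * L ((g * r)\<^sup>2)"
    using b(2)[OF r(1)] a(1) by simp
  also have "\<dots> < L ((f * (g * r))\<^sup>2)" using a(2)[OF \<open>g * r \<noteq> 0\<close>] .
  finally show False using r(2) by (simp add: mult.assoc)
qed

text \<open>
The polynomial is \<open>(X - a)\<^sup>2 + b\<^sup>2\<close>. Expanding the square of its product with \<open>r\<close> gives \<open>b ^ 4 * r\<^sup>2\<close>
plus squares with nonnegative coefficients, so it is bounded below by \<open>b\<^sup>2\<close>: a symmetric operator has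
no spectrum off the real line.
\<close>

lemma not_approx_null_quadratic:
  assumes "b \<noteq> 0"
  shows "\<not> approx_null [:a\<^sup>2 + b\<^sup>2, - 2 * a, 1:]"
proof
  define h where "h = [:- a, 1:]"
  have Q: "[:a\<^sup>2 + b\<^sup>2, - 2 * a, 1:] = h\<^sup>2 + [:b\<^sup>2:]"
    by (simp add: h_def power2_eq_square)
  assume "approx_null [:a\<^sup>2 + b\<^sup>2, - 2 * a, 1:]"
  moreover have "b ^ 4 / 2 > 0" using assms by simp
  ultimately obtain r where r: "r \<noteq> 0" "L (((h\<^sup>2 + [:b\<^sup>2:]) * r)\<^sup>2) \<le> b ^ 4 / 2 * L (r\<^sup>2)"
    unfolding approx_null_def Q by blast
  have "((h\<^sup>2 + [:b\<^sup>2:]) * r)\<^sup>2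
      = (h\<^sup>2 * r)\<^sup>2 + smult (2 * b\<^sup>2) ((h * r)\<^sup>2) + smult (b ^ 4) (r\<^sup>2)"
    by (rule poly_extI) (simp add: power2_eq_square power4_eq_xxxx algebra_simps)
  then have "L (((h\<^sup>2 + [:b\<^sup>2:]) * r)\<^sup>2)
      = L ((h\<^sup>2 * r)\<^sup>2) + 2 * b\<^sup>2 * L ((h * r)\<^sup>2) + b ^ 4 * L (r\<^sup>2)"
    by (simp add: add smult)
  also have "\<dots> \<ge> b ^ 4 * L (r\<^sup>2)" using nonneg[of "h\<^sup>2 * r"] nonneg[of "h * r"] by simp
  finally have "b ^ 4 * L (r\<^sup>2) \<le> b ^ 4 / 2 * L (r\<^sup>2)" using r(2) by linarith
  moreover have "b ^ 4 * L (r\<^sup>2) > 0" using pos[OF r(1)] assms by simp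
  ultimately show False by linarith
qed

end

text \<open>
A nonreal root has the quadratic below as its minimal polynomial over the reals: the remainder of \<open>f\<close>
is linear and vanishes at that root, hence is zero.
\<close>

lemma real_poly_factor:
  fixes f :: "real poly"
  assumes "degree f > 0"
  obtains t where "poly f t = 0" | a b where "b \<noteq> 0" "[:a\<^sup>2 + b\<^sup>2, - 2 * a, 1:] dvd f"
proof -
  have "\<not> constant (poly (map_poly complex_of_real f))"
    using assms by (simp add: constant_degree degree_map_poly)
  then obtain z where z: "poly (map_poly complex_of_real f) z = 0"
    using fundamental_theorem_of_algebra by blast
  show ?thesis
  proof (cases "Im z = 0")
    case True
    then have "z = complex_of_real (Re z)" by (simp add: complex_eq_iff)
    moreover have "poly (map_poly of_real f) (complex_of_real x) = complex_of_real (poly f x)" for x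
      by (induction f) (auto simp: map_poly_pCons)
    ultimately have "complex_of_real (poly f (Re z)) = 0" using z by metis
    then show ?thesis using that(1) by simp
  next
    case False
    define Q where "Q = [:(Re z)\<^sup>2 + (Im z)\<^sup>2, - 2 * Re z, 1:]"
    have Qz: "poly (map_poly complex_of_real Q) z = 0"
      by (simp add: Q_def map_poly_pCons complex_eq_iff power2_eq_square algebra_simps)
    have "degree Q = 2" by (simp add: Q_def)
    then have "degree (f mod Q) < 2" using degree_mod_less[of Q f] by force
    then have R: "f mod Q = [:coeff (f mod Q) 0, coeff (f mod Q) 1:]"
      by (intro poly_eqI) (auto simp: coeff_pCons coeff_eq_0 split: nat.split)
    have "map_poly complex_of_real (p * q + r)
        = map_poly complex_of_real p * map_poly complex_of_real q + map_poly complex_of_real r" for p q r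
      by (intro poly_eqI) (simp add: coeff_map_poly coeff_mult)
    from this[of Q "f div Q" "f mod Q"] have "poly (map_poly complex_of_real (f mod Q)) z = 0" using z Qz by simp
    then have "complex_of_real (coeff (f mod Q) 0) + z * complex_of_real (coeff (f mod Q) 1) = 0"
      by (subst (asm) R) (simp add: map_poly_pCons)
    then have "coeff (f mod Q) 1 = 0" "coeff (f mod Q) 0 = 0"
      using False by (auto simp: complex_eq_iff)
    then have "f mod Q = 0" using R by simp
    then show ?thesis using that(2)[OF False] by (simp add: Q_def mod_eq_0_iff_dvd)
  qed
qed

context positive_functional
begin

text \<open>
The spectral mapping theorem in the form that is needed. Splitting \<open>f\<close> into real factors of degree at
most two, some factor must be approximately null; the quadratic factors without real roots and the
nonzero constants are bounded below, so this factor is linear.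
\<close>

lemma approx_null_root:
  assumes "approx_null f" "f \<noteq> 0"
  shows "\<exists>t. poly f t = 0 \<and> approx_null [:- t, 1:]"
  using assms
proof (induction "degree f" arbitrary: f rule: less_induct)
  case less
  have *: "\<exists>t. poly f t = 0 \<and> approx_null [:- t, 1:]"
    if f: "f = h * g" and "degree h > 0" "\<not> approx_null h" for h g
  proof -
    have "approx_null g" using approx_null_mult less.prems(1) that by blast
    moreover have "g \<noteq> 0" "h \<noteq> 0" using less.prems(2) f by auto
    then have "degree g < degree f" using f that(2) by (simp add: degree_mult_eq)
    ultimately show ?thesis using less.hyps[of g] \<open>g \<noteq> 0\<close> f by auto
  qed
  have "degree f > 0"
  proof (rule ccontr)
    assume "\<not> degree f > 0"
    then obtain c where c: "f = [:c:]" by (metis degree_eq_zeroE neq0_conv)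
    then have "c\<^sup>2 / 2 > 0" using less.prems(2) by simp
    then obtain r where r: "r \<noteq> 0" "L ((f * r)\<^sup>2) \<le> c\<^sup>2 / 2 * L (r\<^sup>2)"
      using less.prems(1) unfolding approx_null_def by blast
    have "L ((f * r)\<^sup>2) = c\<^sup>2 * L (r\<^sup>2)"
      by (simp add: c power2_eq_square smult)
    moreover have "c\<^sup>2 * L (r\<^sup>2) > 0" using pos[OF r(1)] \<open>c\<^sup>2 / 2 > 0\<close> by simp
    ultimately show False using r(2) by linarith
  qed
  then show ?case
  proof (cases rule: real_poly_factor)
    case (1 t)
    then obtain g where "f = [:- t, 1:] * g" by (auto simp: poly_eq_0_iff_dvd)
    then show ?thesis using *[of "[:- t, 1:]" g] 1 by auto
  next
    case (2 a b)
    then obtain g where "f = [:a\<^sup>2 + b\<^sup>2, - 2 * a, 1:] * g" by (elim dvdE)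
    then show ?thesis using *[OF _ _ not_approx_null_quadratic[OF 2(1)]] by simp
  qed
qed

text \<open>
Near a point \<open>t\<close> of the spectrum there are polynomials \<open>r\<close> that are almost annihilated by
\<open>X - t\<close>. As \<open>p = p(t) + (X - t) * u\<close>, multiplication by \<open>p\<close> acts on such an \<open>r\<close> almost as the
scalar \<open>p(t)\<close>, and so the operator norm of \<open>p\<close> is at least \<open>\<bar>p(t)\<bar>\<close>. The hypothesis on \<open>D\<close> is used
twice: for \<open>p\<close>, and to see that the cofactor \<open>u\<close> is bounded.
\<close>

lemma evaluation_bounded:
  assumes null: "approx_null [:- t, 1:]"
    and bdd: "\<And>p r. degree p \<le> n \<Longrightarrow> L ((p * r)\<^sup>2) \<le> D * L (p\<^sup>2) * L (r\<^sup>2)"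
    and p: "degree p \<le> n"
  shows "(poly p t)\<^sup>2 \<le> D * L (p\<^sup>2)"
proof -
  define M K where "M = poly p t" and "K = D * L (p\<^sup>2)"
  define h where "h = [:- t, 1:]"
  define u where "u = synthetic_div p t"
  have pM: "p = [:M:] + h * u"
    using synthetic_div_correct'[of t p] by (simp add: M_def h_def u_def add.commute)
  have "degree u \<le> n" using p by (simp add: u_def degree_synthetic_div)
  define B where "B = \<bar>D * L (u\<^sup>2)\<bar> + 1"
  have "B > 0" by (simp add: B_def)
  have B: "L ((u * r)\<^sup>2) \<le> B * L (r\<^sup>2)" for r
  proof -
    have "L ((u * r)\<^sup>2) \<le> D * L (u\<^sup>2) * L (r\<^sup>2)" using bdd \<open>degree u \<le> n\<close> .
    also have "\<dots> \<le> B * L (r\<^sup>2)" using nonneg[of r] by (intro mult_right_mono) (auto simp: B_def)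
    finally show ?thesis .
  qed
  \<comment> \<open>With \<open>v = (X - t) * u * r\<close> one has \<open>p(t) * r = p * r - v\<close>, and the square of this
    difference is at most \<open>(1 + \<eta>) * (p * r)\<^sup>2 + (1 + 1 / \<eta>) * v\<^sup>2\<close>,
    where the second term is as small as desired.\<close>
  have "M\<^sup>2 \<le> (1 + \<eta>) * K + \<eta>" if "\<eta> > 0" for \<eta>
  proof -
    define k where "k = 1 + 1 / \<eta>"
    have "k > 0" using that by (simp add: k_def add_pos_pos)
    \<comment> \<open>chosen so that the contribution of \<open>v\<close> is at most \<open>\<eta> * L (r\<^sup>2)\<close>\<close>
    define \<epsilon> where "\<epsilon> = \<eta> / (k * B)"
    have "\<epsilon> > 0" using that \<open>B > 0\<close> \<open>k > 0\<close> by (simp add: \<epsilon>_def)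
    have eps: "k * (B * \<epsilon>) = \<eta>"
      using \<open>B > 0\<close> \<open>k > 0\<close> by (simp add: \<epsilon>_def)
    obtain r where r: "r \<noteq> 0" "L ((h * r)\<^sup>2) \<le> \<epsilon> * L (r\<^sup>2)"
      using null \<open>\<epsilon> > 0\<close> unfolding approx_null_def h_def by blast
    define v where "v = h * u * r"
    have "v = u * (h * r)" by (simp add: v_def mult.assoc mult.left_commute)
    then have "L (v\<^sup>2) = L ((u * (h * r))\<^sup>2)" by simp
    also have "\<dots> \<le> B * L ((h * r)\<^sup>2)" using B .
    also have "\<dots> \<le> B * (\<epsilon> * L (r\<^sup>2))" using r(2) \<open>B > 0\<close> by simp
    finally have v: "L (v\<^sup>2) \<le> B * \<epsilon> * L (r\<^sup>2)" by simp
    have Mr: "smult M r = p * r - v" by (subst pM) (simp add: v_def algebra_simps)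
    have "smult (1 + \<eta>) ((p * r)\<^sup>2) + smult k (v\<^sup>2) - (p * r - v)\<^sup>2
        = smult (1 / \<eta>) ((smult \<eta> (p * r) + v)\<^sup>2)"
      using that by (intro poly_extI) (simp add: k_def power2_eq_square field_simps)
    then have "(1 + \<eta>) * L ((p * r)\<^sup>2) + k * L (v\<^sup>2) - L ((p * r - v)\<^sup>2)
        = 1 / \<eta> * L ((smult \<eta> (p * r) + v)\<^sup>2)"
      by (metis add diff smult)
    also have "\<dots> \<ge> 0" using that nonneg by simp
    finally have "L ((smult M r)\<^sup>2) \<le> (1 + \<eta>) * L ((p * r)\<^sup>2) + k * L (v\<^sup>2)"
      by (simp add: Mr)
    also have "\<dots> \<le> (1 + \<eta>) * (K * L (r\<^sup>2)) + k * (B * \<epsilon> * L (r\<^sup>2))"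
      using bdd[OF p, of r] v that \<open>k > 0\<close> by (intro add_mono mult_left_mono) (auto simp: K_def)
    also have "\<dots> = ((1 + \<eta>) * K + \<eta>) * L (r\<^sup>2)"
      using eps by (simp add: algebra_simps)
    finally have "M\<^sup>2 * L (r\<^sup>2) \<le> ((1 + \<eta>) * K + \<eta>) * L (r\<^sup>2)"
      by (simp add: smult power2_eq_square)
    then show ?thesis using pos[OF r(1)] by simp
  qed
  then have "\<forall>\<^sub>F \<eta> in at_right 0. M\<^sup>2 \<le> (1 + \<eta>) * K + \<eta>"
    by (auto simp: eventually_at_right_less eventually_at_filter)
  moreover have "((\<lambda>\<eta>. (1 + \<eta>) * K + \<eta>) \<longlongrightarrow> (1 + 0) * K + 0) (at_right 0)"
    by (intro tendsto_intros)
  ultimately have "M\<^sup>2 \<le> (1 + 0) * K + 0"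
    by (intro tendsto_lowerbound) auto
  then show ?thesis by (simp add: M_def K_def)
qed

text \<open>
Let \<open>q\<close> be the sum of the squares of an orthonormal basis \<open>P 0, \<dots>, P n\<close> of the polynomials of
degree at most \<open>n\<close>, so that \<open>L q = n + 1\<close>: this is the trace of the identity on an
\<open>(n + 1)\<close>-dimensional space. Let \<open>M\<close> be the supremum of the quadratic form of \<open>q\<close>; it is at
least \<open>L q\<close>, the value of the form at the unit vector \<open>1\<close>. As the top of the spectrum of a symmetric
operator, \<open>M\<close> is attained: \<open>q(t) = M\<close> for some spectral point \<open>t\<close>. The reproducing kernel
\<open>k = (\<Sum>i\<le>n. P i (t) * P i)\<close> of evaluation at \<open>t\<close> satisfies \<open>k(t) = L (k\<^sup>2) = q(t) = M\<close>, and
comparing its value at \<open>t\<close> with its norm gives \<open>M\<^sup>2 \<le> D * M\<close>.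
\<close>

theorem dimension_bound:
  assumes "L 1 = 1" and "n > 0"
    and bdd: "\<And>p r. degree p \<le> n \<Longrightarrow> L ((p * r)\<^sup>2) \<le> D * L (p\<^sup>2) * L (r\<^sup>2)"
  shows "real n + 1 \<le> D"
proof -
  obtain P where deg: "\<And>i. i \<le> n \<Longrightarrow> degree (P i) = i"
    and orth: "\<And>i j. i \<le> n \<Longrightarrow> j \<le> n \<Longrightarrow> L (P i * P j) = (if i = j then 1 else 0)"
    using orthonormal_polynomials[of "Suc n"] by (auto simp: less_Suc_eq_le)
  define q where "q = (\<Sum>i\<le>n. (P i)\<^sup>2)"
  have Lq: "L (q * r\<^sup>2) = (\<Sum>i\<le>n. L ((P i * r)\<^sup>2))" for r
    by (simp add: q_def sum_distrib_right sum power_mult_distrib)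
  define A where "A = (\<lambda>r. L (q * r\<^sup>2) / L (r\<^sup>2)) ` {r. r \<noteq> 0}"
  define M where "M = Sup A"
  have "bdd_above A"
  proof (unfold A_def, rule bdd_aboveI2)
    fix r :: "real poly" assume "r \<in> {r. r \<noteq> 0}"
    then have r: "L (r\<^sup>2) > 0" using pos by simp
    have "L (q * r\<^sup>2) \<le> (\<Sum>i\<le>n. D * L (r\<^sup>2))"
      unfolding Lq
    proof (rule sum_mono)
      fix i assume "i \<in> {..n}"
      then show "L ((P i * r)\<^sup>2) \<le> D * L (r\<^sup>2)"
        using bdd[of "P i" r] deg[of i] orth[of i i] by (simp add: power2_eq_square)
    qed
    then show "L (q * r\<^sup>2) / L (r\<^sup>2) \<le> (real n + 1) * D"
      using r by (simp add: divide_le_eq algebra_simps)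
  qed
  have upper: "L (q * r\<^sup>2) \<le> M * L (r\<^sup>2)" for r
  proof (cases "r = 0")
    case False
    then have "L (q * r\<^sup>2) / L (r\<^sup>2) \<le> M"
      unfolding M_def using \<open>bdd_above A\<close> by (intro cSup_upper) (auto simp: A_def)
    then show ?thesis using pos[OF False] by (simp add: divide_le_eq)
  qed simp
  have "L q = real n + 1"
    using orth by (simp add: q_def sum power2_eq_square)
  then have nM: "real n + 1 \<le> M" using upper[of 1] \<open>L 1 = 1\<close> by simp
  then have "M > 0" by simp
  define f where "f = [:M:] - q"
  have Lf: "L (f * r\<^sup>2) = M * L (r\<^sup>2) - L (q * r\<^sup>2)" for r
    by (simp add: f_def left_diff_distrib diff smult)
  \<comment> \<open>The form of \<open>M * f - f\<^sup>2 = f * q\<close> is nonnegative: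
    \<open>q\<close> is a sum of squares, and the form of \<open>f\<close> is nonnegative. Hence a
    vector on which the form of \<open>f\<close> is small is almost annihilated by
    \<open>f\<close>.\<close>
  have square: "L ((f * r)\<^sup>2) \<le> M * L (f * r\<^sup>2)" for r
  proof -
    have "smult M (f * r\<^sup>2) - (f * r)\<^sup>2 = f * q * r\<^sup>2"
      by (rule poly_extI) (simp add: f_def power2_eq_square algebra_simps)
    also have "\<dots> = (\<Sum>i\<le>n. f * (P i * r)\<^sup>2)"
      by (simp add: q_def sum_distrib_left sum_distrib_right power_mult_distrib mult_ac)
    finally have "L (smult M (f * r\<^sup>2) - (f * r)\<^sup>2) = (\<Sum>i\<le>n. L (f * (P i * r)\<^sup>2))"
      by (simp add: sum)
    also have "\<dots> \<ge> 0" using upper by (intro sum_nonneg) (simp add: Lf)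
    finally show ?thesis by (simp add: diff smult)
  qed
  have null: "approx_null f"
    unfolding approx_null_def
  proof (intro allI impI)
    fix \<epsilon> :: real assume "\<epsilon> > 0"
    then have "M - \<epsilon> / M < Sup A" using \<open>M > 0\<close> by (simp add: M_def)
    moreover have "A \<noteq> {}" by (auto simp: A_def intro: exI[of _ 1])
    ultimately obtain y where "y \<in> A" "M - \<epsilon> / M < y" using less_cSupD by blast
    then obtain r where r: "r \<noteq> 0" "M - \<epsilon> / M < L (q * r\<^sup>2) / L (r\<^sup>2)" by (auto simp: A_def)
    then have "L (f * r\<^sup>2) \<le> \<epsilon> / M * L (r\<^sup>2)"
      using pos[OF r(1)] by (simp add: Lf less_divide_eq algebra_simps)
    then have "M * L (f * r\<^sup>2) \<le> \<epsilon> * L (r\<^sup>2)"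
      using \<open>M > 0\<close> by (simp add: field_simps)
    then show "\<exists>r. r \<noteq> 0 \<and> L ((f * r)\<^sup>2) \<le> \<epsilon> * L (r\<^sup>2)"
      using square[of r] r(1) by force
  qed
  \<comment> \<open>The polynomial \<open>f\<close> is nonzero, because \<open>P n\<close> alone
    contributes to the coefficient of \<open>q\<close> in degree \<open>2 * n\<close>. This fails for \<open>n = 0\<close>,
    where \<open>q\<close> is constant and equal to \<open>M\<close>.\<close>
  have "coeff ((P i)\<^sup>2) (n + n) = (if i = n then (lead_coeff (P n))\<^sup>2 else 0)" if "i \<le> n" for i
    using that deg[OF that] deg[of n] coeff_mult_degree_sum[of "P n" "P n"]
      degree_mult_le[of "P i" "P i"]
    by (auto simp: power2_eq_square intro!: coeff_eq_0)
  then have "coeff q (n + n) = (lead_coeff (P n))\<^sup>2" by (simp add: q_def coeff_sum)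
  moreover have "P n \<noteq> 0" using deg[of n] \<open>n > 0\<close> by auto
  ultimately have "coeff f (n + n) \<noteq> 0"
    using \<open>n > 0\<close> by (simp add: f_def coeff_pCons split: nat.split)
  then have "f \<noteq> 0" by auto
  then obtain t where t: "poly f t = 0" "approx_null [:- t, 1:]"
    using approx_null_root null by blast
  define k where "k = (\<Sum>i\<le>n. smult (poly (P i) t) (P i))"
  have "degree k \<le> n" unfolding k_def using deg by (intro degree_sum_le) auto
  have "(\<Sum>i\<le>n. (poly (P i) t)\<^sup>2) = M"
    using t(1) by (simp add: f_def q_def poly_sum)
  then have kt: "poly k t = M" by (simp add: k_def poly_sum power2_eq_square)
  have "L (k\<^sup>2) = (\<Sum>i\<le>n. \<Sum>j\<le>n. poly (P i) t * (poly (P j) t * L (P i * P j)))"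
    by (simp add: k_def power2_eq_square sum_product sum smult mult_ac)
  also have "\<dots> = (\<Sum>i\<le>n. \<Sum>j\<le>n. if i = j then (poly (P i) t)\<^sup>2 else 0)"
    by (intro sum.cong) (auto simp: orth power2_eq_square)
  also have "\<dots> = M" using \<open>(\<Sum>i\<le>n. (poly (P i) t)\<^sup>2) = M\<close> by simp
  finally have "M\<^sup>2 \<le> D * M"
    using evaluation_bounded[OF t(2) bdd \<open>degree k \<le> n\<close>] kt by simp
  then have "M \<le> D" using \<open>M > 0\<close> by (simp add: power2_eq_square)
  with nM show ?thesis by simp
qed

end


section \<open>Polynomials in the sum of the generators\<close>

text \<open>
Throughout, \<open>x\<close> denotes the sum, in the group algebra, of the elements of the symmetric set
\<open>S \<union> m_inv G ` S\<close>. The coefficient of \<open>x ^ k\<close> at a group element counts the words of length \<open>k\<close>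
that represent it, and working with words instead of with iterated convolutions turns the algebraic
identities below into bijections between finite sets.
\<close>

locale finite_generators = group G for G :: "('a, 'b) monoid_scheme" (structure) +
  fixes S :: "'a set"
  assumes finite_S: "finite S" and S_carrier: "S \<subseteq> carrier G"
begin

definition words :: "nat \<Rightarrow> 'a list set" where
  "words k = {ws. length ws = k \<and> set ws \<subseteq> S \<union> m_inv G ` S}"

definition word_value :: "'a list \<Rightarrow> 'a" where
  "word_value ws = foldr (\<otimes>) ws \<one>"

definition walks :: "nat \<Rightarrow> 'a \<Rightarrow> real" where
  "walks k g = real (card {ws \<in> words k. word_value ws = g})"

text \<open>
The function \<open>poly_elt p\<close> is the element \<open>p(x)\<close> of the group algebra. Real coefficients are enough,
because \<open>x\<close> is self-adjoint with real coefficients.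
\<close>

definition poly_elt :: "real poly \<Rightarrow> 'a \<Rightarrow> real" where
  "poly_elt p g = (\<Sum>k\<le>degree p. coeff p k * walks k g)"

definition word_ball :: "nat \<Rightarrow> 'a set" where
  "word_ball n = (\<Union>k\<le>n. word_value ` words k)"

text \<open>
The moments of this functional, its values at the monomials, count the closed walks in the Cayley
graph; it is integration against the spectral measure of \<open>x\<close>.
\<close>

definition canonical_trace :: "real poly \<Rightarrow> real" where
  "canonical_trace p = poly_elt p \<one>"

lemma finite_words: "finite (words k)"
  using finite_lists_length_eq[of "S \<union> m_inv G ` S" k] finite_S
  by (simp add: words_def conj_commute)

lemma words_carrier: "ws \<in> words k \<Longrightarrow> set ws \<subseteq> carrier G"
  using S_carrier by (auto simp: words_def)

lemma word_value_closed: "set ws \<subseteq> carrier G \<Longrightarrow> word_value ws \<in> carrier G"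
  by (induction ws) (auto simp: word_value_def)

lemma word_value_words: "ws \<in> words k \<Longrightarrow> word_value ws \<in> carrier G"
  using word_value_closed words_carrier by blast

lemma word_value_append:
  assumes "set us \<subseteq> carrier G" "set vs \<subseteq> carrier G"
  shows "word_value (us @ vs) = word_value us \<otimes> word_value vs"
  using assms(1)
proof (induction us)
  case Nil
  then show ?case using word_value_closed[OF assms(2)] by (simp add: word_value_def)
next
  case (Cons u us)
  then show ?case using word_value_closed[OF assms(2)] word_value_closed[of us]
    by (simp add: word_value_def m_assoc)
qed

lemma word_value_inverse:
  "set ws \<subseteq> carrier G \<Longrightarrow> word_value (map (m_inv G) (rev ws)) = inv (word_value ws)"
proof (induction ws)
  case Nil
  show ?case by (simp add: word_value_def)
next
  case (Cons w ws)
  have "word_value (map (m_inv G) (rev ws) @ [inv w]) = word_value (map (m_inv G) (rev ws)) \<otimes> word_value [inv w]"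
    using Cons.prems by (intro word_value_append) auto
  also have "\<dots> = inv (word_value ws) \<otimes> inv w"
    using Cons by (simp add: word_value_def)
  also have "\<dots> = inv (word_value (w # ws))"
    using Cons.prems word_value_closed[of ws] by (simp add: word_value_def inv_mult_group)
  finally show ?case by simp
qed

text \<open>
Reversing a word and inverting its letters exchanges the words for \<open>g\<close> and for its inverse; this is
where the symmetry of the generating set enters, and it makes \<open>x\<close> self-adjoint.
\<close>

lemma walks_inverse:
  assumes "g \<in> carrier G"
  shows "walks k (inv g) = walks k g"
proof -
  have inv2: "map (m_inv G) (rev (map (m_inv G) (rev ws))) = ws" if "ws \<in> words k" for ws
    using words_carrier[OF that] by (auto simp: rev_map subset_iff intro!: map_idI)
  have mem: "map (m_inv G) (rev ws) \<in> words k" if "ws \<in> words k" for ws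
  proof -
    have inv_letter: "inv t \<in> S \<union> m_inv G ` S" if "t \<in> S \<union> m_inv G ` S" for t
      using that S_carrier by auto
    have "\<forall>t\<in>set ws. inv t \<in> S \<union> m_inv G ` S"
    proof
      fix t assume "t \<in> set ws"
      then have "t \<in> S \<union> m_inv G ` S" using that unfolding words_def by blast
      then show "inv t \<in> S \<union> m_inv G ` S" by (rule inv_letter)
    qed
    then show ?thesis using that by (simp add: words_def image_subset_iff del: Un_iff)
  qed
  have val: "word_value (map (m_inv G) (rev ws)) = inv (word_value ws)" if "ws \<in> words k" for ws
    using word_value_inverse words_carrier that by blast
  have "bij_betw (\<lambda>ws. map (m_inv G) (rev ws))
      {ws \<in> words k. word_value ws = inv g} {ws \<in> words k. word_value ws = g}"
    by (rule bij_betw_byWitness[where f' = "\<lambda>ws. map (m_inv G) (rev ws)"])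
      (simp_all add: inv2 mem val assms image_subset_iff)
  then show ?thesis by (simp add: walks_def bij_betw_same_card)
qed

lemma walks_eq_sum: "walks k g = (\<Sum>ws\<in>words k. if word_value ws = g then 1 else 0)"
  using finite_words by (simp add: walks_def sum.If_cases Int_def)

lemma sum_walks_mult:
  assumes "finite A" "word_value ` words k \<subseteq> A"
  shows "(\<Sum>g\<in>A. walks k g * F g) = (\<Sum>ws\<in>words k. F (word_value ws))"
proof -
  have "(\<Sum>g\<in>A. walks k g * F g) = (\<Sum>g\<in>A. \<Sum>ws\<in>words k. if word_value ws = g then F g else 0)"
    by (simp add: walks_eq_sum sum_distrib_right if_distrib[of "\<lambda>x. x * F _"] cong: if_cong)
  also have "\<dots> = (\<Sum>ws\<in>words k. \<Sum>g\<in>A. if word_value ws = g then F g else 0)"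
    by (rule sum.swap)
  also have "\<dots> = (\<Sum>ws\<in>words k. F (word_value ws))"
    using assms by (intro sum.cong) (auto simp: sum.delta' image_subset_iff)
  finally show ?thesis .
qed

text \<open>
The law \<open>x ^ (j + k) = x ^ j * x ^ k\<close>, read off from cutting a word of length \<open>j + k\<close> after its first
\<open>j\<close> letters.
\<close>

lemma walks_add:
  assumes "g \<in> carrier G"
  shows "walks (j + k) g = (\<Sum>us\<in>words j. walks k (inv (word_value us) \<otimes> g))"
proof -
  have bij: "bij_betw (\<lambda>(us, vs). us @ vs) (words j \<times> words k) (words (j + k))"
    by (rule bij_betw_byWitness[where f' = "\<lambda>ws. (take j ws, drop j ws)"])
      (auto simp: words_def dest: in_set_takeD in_set_dropD)
  have eq: "word_value (us @ vs) = g \<longleftrightarrow> word_value vs = inv (word_value us) \<otimes> g"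
    if "us \<in> words j" "vs \<in> words k" for us vs
    using that assms words_carrier word_value_words
    by (metis word_value_append inv_closed inv_solve_left')
  have "walks (j + k) g = (\<Sum>(us, vs)\<in>words j \<times> words k. if word_value (us @ vs) = g then 1 else 0)"
    unfolding walks_eq_sum by (subst sum.reindex_bij_betw[OF bij, symmetric]) (simp add: case_prod_beta)
  also have "\<dots> = (\<Sum>us\<in>words j. walks k (inv (word_value us) \<otimes> g))"
    unfolding walks_eq_sum sum.cartesian_product[symmetric] using eq by (intro sum.cong) auto
  finally show ?thesis .
qed

lemma walks_convolution:
  assumes "finite A" "word_value ` words j \<subseteq> A" "g \<in> carrier G"
  shows "(\<Sum>h\<in>A. walks j h * walks k (inv h \<otimes> g)) = walks (j + k) g"
  using sum_walks_mult[OF assms(1,2)] walks_add[OF assms(3)] by simp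

lemma poly_elt_eq: "degree p \<le> N \<Longrightarrow> poly_elt p g = (\<Sum>k\<le>N. coeff p k * walks k g)"
  unfolding poly_elt_def by (intro sum.mono_neutral_left) (auto simp: coeff_eq_0)

lemma poly_elt_add: "poly_elt (p + q) g = poly_elt p g + poly_elt q g"
  using poly_elt_eq[of _ "max (degree p) (degree q)" g] degree_add_le_max[of p q]
  by (simp add: sum.distrib algebra_simps)

lemma poly_elt_smult: "poly_elt (smult c p) g = c * poly_elt p g"
  using poly_elt_eq[of _ "degree p" g] degree_smult_le[of c p]
  by (simp add: sum_distrib_left mult.assoc)

lemma poly_elt_sum: "poly_elt (sum f A) g = (\<Sum>i\<in>A. poly_elt (f i) g)"
proof (induction A rule: infinite_finite_induct)
  case (insert x F)
  then show ?case by (simp add: poly_elt_add)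
qed (simp_all add: poly_elt_def)

lemma poly_elt_monom: "poly_elt (monom c k) g = c * walks k g"
  using poly_elt_eq[OF degree_monom_le[of c k]] by (simp add: if_distrib[of "\<lambda>x. x * _"] cong: if_cong)

lemma poly_elt_mult:
  assumes "finite A" "word_ball (degree p) \<subseteq> A" "g \<in> carrier G"
  shows "poly_elt (p * q) g = (\<Sum>h\<in>A. poly_elt p h * poly_elt q (inv h \<otimes> g))"
proof -
  let ?m = "degree p" and ?n = "degree q"
  have "p * q = (\<Sum>j\<le>?m. monom (coeff p j) j) * (\<Sum>k\<le>?n. monom (coeff q k) k)"
    by (simp add: poly_as_sum_of_monoms)
  also have "\<dots> = (\<Sum>j\<le>?m. \<Sum>k\<le>?n. monom (coeff p j * coeff q k) (j + k))"
    by (simp add: sum_product mult_monom)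
  finally have "poly_elt (p * q) g = (\<Sum>j\<le>?m. \<Sum>k\<le>?n. coeff p j * coeff q k * walks (j + k) g)"
    by (simp add: poly_elt_sum poly_elt_monom)
  also have "\<dots> = (\<Sum>j\<le>?m. \<Sum>k\<le>?n. \<Sum>h\<in>A. coeff p j * walks j h * (coeff q k * walks k (inv h \<otimes> g)))"
  proof (intro sum.cong refl)
    fix j k assume "j \<in> {..?m}"
    then have "word_value ` words j \<subseteq> A" using assms(2) by (auto simp: word_ball_def)
    then have "walks (j + k) g = (\<Sum>h\<in>A. walks j h * walks k (inv h \<otimes> g))"
      using walks_convolution[OF assms(1) _ assms(3)] by simp
    then show "coeff p j * coeff q k * walks (j + k) g
        = (\<Sum>h\<in>A. coeff p j * walks j h * (coeff q k * walks k (inv h \<otimes> g)))"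
      by (simp only: sum_distrib_left mult_ac)
  qed
  also have "\<dots> = (\<Sum>h\<in>A. poly_elt p h * poly_elt q (inv h \<otimes> g))"
    unfolding poly_elt_def sum_product by (subst sum.swap[of _ A], subst sum.swap[of _ A]) (rule refl)
  finally show ?thesis .
qed

lemma poly_elt_outside_ball:
  assumes "g \<notin> word_ball (degree p)"
  shows "poly_elt p g = 0"
proof -
  have "walks k g = 0" if "k \<le> degree p" for k
  proof -
    have "{ws \<in> words k. word_value ws = g} = {}" using assms that by (auto simp: word_ball_def)
    then show ?thesis by (simp only: walks_def card.empty of_nat_0)
  qed
  then show ?thesis by (simp add: poly_elt_def)
qed

lemma word_length_le:
  "ws \<in> words k \<Longrightarrow> word_length G S (word_value ws) \<le> k"
  unfolding word_length_def by (rule Least_le) (auto simp: words_def word_value_def)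

lemma word_length_ball: "g \<in> word_ball n \<Longrightarrow> word_length G S g \<le> n"
  unfolding word_ball_def by (auto intro: order.trans[OF word_length_le])

lemma finite_word_ball: "finite (word_ball n)"
  using finite_words by (simp add: word_ball_def)

lemma word_ball_carrier: "word_ball n \<subseteq> carrier G"
  using word_value_words by (auto simp: word_ball_def)

lemma poly_elt_group_algebra: "(\<lambda>g. complex_of_real (poly_elt p g)) \<in> group_algebra G"
proof -
  have "{g. poly_elt p g \<noteq> 0} \<subseteq> word_ball (degree p)"
    using poly_elt_outside_ball by blast
  then show ?thesis
    using finite_word_ball word_ball_carrier by (auto simp: group_algebra_def intro: finite_subset)
qed

lemma poly_elt_inverse: "g \<in> carrier G \<Longrightarrow> poly_elt p (inv g) = poly_elt p g"
  by (simp add: poly_elt_def walks_inverse)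

lemma convolution_poly_elt:
  "convolution G (\<lambda>g. complex_of_real (poly_elt p g)) (\<lambda>g. complex_of_real (poly_elt q g))
    = (\<lambda>g. complex_of_real (poly_elt (p * q) g))"
proof
  fix g
  let ?A = "word_ball (degree p)"
  show "convolution G (\<lambda>g. complex_of_real (poly_elt p g)) (\<lambda>g. complex_of_real (poly_elt q g)) g
      = complex_of_real (poly_elt (p * q) g)"
  proof (cases "g \<in> carrier G")
    case True
    have "convolution G (\<lambda>g. complex_of_real (poly_elt p g)) (\<lambda>g. complex_of_real (poly_elt q g)) g
        = (\<Sum>h\<in>?A. complex_of_real (poly_elt p h) * complex_of_real (poly_elt q (inv h \<otimes> g)))"
      unfolding convolution_def using True finite_word_ball poly_elt_outside_ball
      by (auto intro!: sum.mono_neutral_left)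
    also have "\<dots> = complex_of_real (poly_elt (p * q) g)"
      using poly_elt_mult[OF finite_word_ball order.refl True] by simp
    finally show ?thesis .
  next
    case False
    then have "poly_elt (p * q) g = 0"
      using poly_elt_outside_ball word_ball_carrier by blast
    then show ?thesis using False by (simp add: convolution_def)
  qed
qed

lemma group_algebra_ell2:
  assumes "a \<in> group_algebra G"
  shows "a \<in> ell2 G"
proof -
  have "(\<lambda>g. (cmod (a g))\<^sup>2) summable_on {g. a g \<noteq> 0}"
    using assms by (intro summable_on_finite) (simp add: group_algebra_def)
  then have "(\<lambda>g. (cmod (a g))\<^sup>2) summable_on carrier G"
    using assms by (subst summable_on_cong_neutral[where T = "{g. a g \<noteq> 0}"]) (auto simp: group_algebra_def)
  then show ?thesis using assms by (auto simp: ell2_def group_algebra_def)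
qed

text \<open>
The coefficient at the identity of \<open>p(x) * p(x)\<close> is a sum of products of coefficients of \<open>p(x)\<close> at
\<open>h\<close> and at the inverse of \<open>h\<close>, which are equal because \<open>p(x)\<close> is self-adjoint.
\<close>

lemma canonical_trace_square:
  "canonical_trace (p\<^sup>2) = (ell2_norm G (\<lambda>g. complex_of_real (poly_elt p g)))\<^sup>2"
proof -
  let ?A = "word_ball (degree p)"
  have "canonical_trace (p\<^sup>2) = (\<Sum>h\<in>?A. poly_elt p h * poly_elt p (inv h \<otimes> \<one>))"
    unfolding canonical_trace_def power2_eq_square by (rule poly_elt_mult) (use finite_word_ball in auto)
  also have "\<dots> = (\<Sum>h\<in>?A. (poly_elt p h)\<^sup>2)"
  proof (rule sum.cong[OF refl])
    fix h assume "h \<in> ?A"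
    then have "h \<in> carrier G" using word_ball_carrier by blast
    then show "poly_elt p h * poly_elt p (inv h \<otimes> \<one>) = (poly_elt p h)\<^sup>2"
      by (simp add: poly_elt_inverse power2_eq_square)
  qed
  also have "\<dots> = (\<Sum>\<^sub>\<infinity>h\<in>?A. (poly_elt p h)\<^sup>2)"
    using finite_word_ball by (rule infsum_finite[symmetric])
  also have "\<dots> = (\<Sum>\<^sub>\<infinity>h\<in>carrier G. (poly_elt p h)\<^sup>2)"
    using word_ball_carrier poly_elt_outside_ball by (intro infsum_cong_neutral) auto
  finally show ?thesis
    by (simp add: ell2_norm_def infsum_nonneg)
qed

lemma ell2_norm_convolution_le:
  assumes a: "a \<in> group_algebra G" and \<xi>: "\<xi> \<in> ell2 G" and pos: "ell2_norm G \<xi> > 0"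
  shows "ell2_norm G (convolution G a \<xi>) \<le> operator_norm G a * ell2_norm G \<xi>"
proof -
  have scale: "ell2_norm G (\<lambda>g. of_real c * \<eta> g) = c * ell2_norm G \<eta>" if "c \<ge> 0" for c \<eta>
    using that by (simp add: ell2_norm_def norm_mult power_mult_distrib infsum_cmult_right' real_sqrt_mult)
  define c where "c = 1 / ell2_norm G \<xi>"
  have c: "c > 0" using pos by (simp add: c_def)
  define \<zeta> where "\<zeta> = (\<lambda>g. of_real c * \<xi> g)"
  have "\<zeta> \<in> ell2 G" using \<xi> c
    by (auto simp: \<zeta>_def ell2_def norm_mult power_mult_distrib intro!: summable_on_cmult_right)
  moreover have "ell2_norm G \<zeta> \<le> 1" using pos c unfolding \<zeta>_def by (subst scale) (simp_all add: c_def)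
  ultimately have "ell2_norm G (convolution G a \<zeta>) \<le> operator_norm G a"
    unfolding operator_norm_def using convolution_bounded(2)[OF group_axioms a]
    by (intro cSUP_upper) auto
  moreover have "convolution G a \<zeta> = (\<lambda>g. of_real c * convolution G a \<xi> g)"
    by (auto simp: convolution_def \<zeta>_def sum_distrib_left mult_ac)
  then have "ell2_norm G (convolution G a \<zeta>) = c * ell2_norm G (convolution G a \<xi>)"
    using c by (simp only: scale less_imp_le)
  ultimately show ?thesis using pos by (simp add: c_def field_simps)
qed

lemma ex_word:
  assumes gen: "generate G S = carrier G" and "g \<in> carrier G"
  shows "\<exists>ws. ws \<in> words (word_length G S g) \<and> word_value ws = g"
proof -
  have "\<exists>n ws. length ws = n \<and> set ws \<subseteq> S \<union> m_inv G ` S \<and> foldr (\<otimes>) ws \<one> = g"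
    using word_exists[OF group_axioms S_carrier] assms by blast
  then show ?thesis
    unfolding word_length_def words_def word_value_def
    by (rule LeastI2_ex) auto
qed

text \<open>
An infinite group has elements outside each ball. A suffix of length \<open>k\<close> of a shortest word for such
an element is again a shortest word, since otherwise the whole word could be shortened.
\<close>

lemma ex_word_length:
  assumes "infinite (carrier G)" and gen: "generate G S = carrier G"
  shows "\<exists>g\<in>carrier G. word_length G S g = k"
proof -
  note ex = ex_word[OF gen]
  have "\<not> carrier G \<subseteq> word_ball k"
    using assms(1) finite_word_ball finite_subset by blast
  then obtain g where g: "g \<in> carrier G" "g \<notin> word_ball k" by blast
  obtain ws where ws: "ws \<in> words (word_length G S g)" "word_value ws = g" using ex g(1) by blast
  have k: "k \<le> word_length G S g"
  proof (rule ccontr)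
    assume "\<not> k \<le> word_length G S g"
    then have "word_value ws \<in> word_ball k" using ws(1) by (auto simp: word_ball_def)
    then show False using ws(2) g(2) by simp
  qed
  define us vs where "us = take (length ws - k) ws" and "vs = drop (length ws - k) ws"
  have len: "length ws = word_length G S g" using ws by (simp add: words_def)
  have us: "us \<in> words (length ws - k)" and vs: "vs \<in> words k"
    using ws k len by (auto simp: words_def us_def vs_def dest: in_set_takeD in_set_dropD)
  obtain vs' where vs': "vs' \<in> words (word_length G S (word_value vs))" "word_value vs' = word_value vs"
    using ex word_value_words[OF vs] by blast
  have "word_value (us @ vs') = word_value (us @ vs)"
    using vs'(2) word_value_append[OF words_carrier[OF us] words_carrier[OF vs]]
      word_value_append[OF words_carrier[OF us] words_carrier[OF vs'(1)]] by simp
  also have "\<dots> = g" using ws(2) by (simp add: us_def vs_def)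
  finally have "word_value (us @ vs') = g" .
  moreover have "us @ vs' \<in> words (length ws - k + word_length G S (word_value vs))"
    using us vs'(1) by (simp add: words_def)
  ultimately have "word_length G S g \<le> length ws - k + word_length G S (word_value vs)"
    using word_length_le by blast
  then have "word_length G S (word_value vs) = k"
    using word_length_le[OF vs] len k by linarith
  then show ?thesis using word_value_words[OF vs] by blast
qed

text \<open>
By the formula for squares, positivity is the linear independence of the powers of \<open>x\<close>, which an
infinite group guarantees: at an element whose length is exactly the degree of \<open>p\<close>, the leading term
alone contributes to \<open>p(x)\<close>.
\<close>

lemma canonical_trace_positive:
  assumes "infinite (carrier G)" and "generate G S = carrier G"
  shows "positive_functional canonical_trace"
proof
  fix p :: "real poly" assume "p \<noteq> 0"
  obtain g where g: "g \<in> carrier G" "word_length G S g = degree p"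
    using ex_word_length[OF assms] by blast
  have zero: "walks k g = 0" if "k < degree p" for k
  proof -
    have "{ws \<in> words k. word_value ws = g} = {}"
      using that g(2) word_length_le[of _ k] by fastforce
    then show ?thesis by (simp only: walks_def card.empty of_nat_0)
  qed
  have "poly_elt p g = lead_coeff p * walks (degree p) g"
    unfolding poly_elt_def using zero by (subst sum.remove[of _ "degree p"]) (auto intro!: sum.neutral)
  moreover have "walks (degree p) g > 0"
  proof -
    obtain ws where "ws \<in> words (degree p)" "word_value ws = g"
      using ex_word[OF assms(2) g(1)] g(2) by auto
    then have "{ws \<in> words (degree p). word_value ws = g} \<noteq> {}" by blast
    then show ?thesis using finite_words[of "degree p"] by (simp add: walks_def card_gt_0_iff)
  qed
  ultimately have "poly_elt p g \<noteq> 0" using \<open>p \<noteq> 0\<close> by simp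
  then have "0 < (\<Sum>h\<in>{g}. (poly_elt p h)\<^sup>2)" by simp
  also have "\<dots> = (\<Sum>\<^sub>\<infinity>h\<in>{g}. (poly_elt p h)\<^sup>2)" by simp
  also have "\<dots> \<le> (\<Sum>\<^sub>\<infinity>h\<in>carrier G. (poly_elt p h)\<^sup>2)"
    using group_algebra_ell2[OF poly_elt_group_algebra[of p]] g(1)
    by (intro infsum_mono2) (auto simp: ell2_def)
  finally show "canonical_trace (p\<^sup>2) > 0" unfolding canonical_trace_square by (simp add: ell2_norm_def)
qed (auto simp: canonical_trace_def poly_elt_add poly_elt_smult)

end

section \<open>The degree of rapid decay\<close>

theorem theorem3p3:
  fixes G :: "('a, 'b) monoid_scheme" and S :: "'a set" and s :: real
  assumes "group G" and "infinite (carrier G)"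
    and "finite S" and "S \<subseteq> carrier G" and "generate G S = carrier G"
    and "s \<ge> 0"
    and "RD_bullet G S s"
  shows "s \<ge> 1 / 2"
proof -
  interpret finite_generators G S
    using assms by (simp add: finite_generators_def finite_generators_axioms_def)
  interpret positive_functional canonical_trace
    using canonical_trace_positive assms(2,5) .
  obtain C where "C \<ge> 0" and C: "\<And>n a. a \<in> group_algebra G \<Longrightarrow>
      (\<And>g. a g \<noteq> 0 \<Longrightarrow> word_length G S g \<le> n) \<Longrightarrow>
      operator_norm G a \<le> C * (1 + real n) powr s * ell2_norm G a"
    using assms(7) unfolding RD_bullet_def by blast
  have "canonical_trace 1 = 1"
    by (simp add: canonical_trace_def poly_elt_def walks_def words_def word_value_def conj_commute cong: conj_cong)
  have growth: "real n + 1 \<le> (C * (1 + real n) powr s)\<^sup>2" if "n > 0" for n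
  proof (rule dimension_bound[OF \<open>canonical_trace 1 = 1\<close> that])
    fix p r :: "real poly" assume p: "degree p \<le> n"
    let ?N = "\<lambda>p. ell2_norm G (\<lambda>g. complex_of_real (poly_elt p g))"
    show "canonical_trace ((p * r)\<^sup>2) \<le> (C * (1 + real n) powr s)\<^sup>2 * canonical_trace (p\<^sup>2) * canonical_trace (r\<^sup>2)"
    proof (cases "r = 0")
      case False
      have N0: "?N q \<ge> 0" for q by (simp add: ell2_norm_def infsum_nonneg)
      have "?N r \<noteq> 0" using pos[OF False] canonical_trace_square[of r] by auto
      then have "?N r > 0" using N0[of r] by linarith
      then have "?N (p * r) \<le> operator_norm G (\<lambda>g. complex_of_real (poly_elt p g)) * ?N r"
        using ell2_norm_convolution_le[OF poly_elt_group_algebra[of p]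
            group_algebra_ell2[OF poly_elt_group_algebra[of r]]]
        by (simp only: convolution_poly_elt)
      also have "\<dots> \<le> C * (1 + real n) powr s * ?N p * ?N r"
      proof (rule mult_right_mono[OF C[OF poly_elt_group_algebra] N0])
        fix g assume "complex_of_real (poly_elt p g) \<noteq> 0"
        then have "g \<in> word_ball (degree p)" using poly_elt_outside_ball by fastforce
        then show "word_length G S g \<le> n" using word_length_ball p order.trans by blast
      qed
      finally have "(?N (p * r))\<^sup>2 \<le> (C * (1 + real n) powr s * ?N p * ?N r)\<^sup>2"
        using N0 by (intro power_mono) auto
      then show ?thesis unfolding canonical_trace_square by (simp only: power_mult_distrib)
    qed simp
  qed
  show ?thesis
  proof (rule ccontr)
    assume "\<not> s \<ge> 1 / 2"
    then have e: "1 - 2 * s > 0" by simp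
    \<comment> \<open>For \<open>s < 1 / 2\<close> the exponent \<open>1 - 2 * s\<close> is
      positive, so that the left-hand side is unbounded.\<close>
    have bound: "(1 + real n) powr (1 - 2 * s) \<le> C\<^sup>2" if "n > 0" for n
    proof -
      have "(1 + real n) powr (1 - 2 * s) * (1 + real n) powr (2 * s) = 1 + real n"
        by (simp flip: powr_add)
      also have "\<dots> \<le> C\<^sup>2 * (1 + real n) powr (2 * s)"
        using growth[OF that] by (simp add: power_mult_distrib powr_power mult.commute)
      finally show ?thesis by (rule mult_right_le_imp_le) simp
    qed
    have "filterlim (\<lambda>n. (1 + real n) powr (1 - 2 * s)) at_top sequentially"
      using e by real_asymp
    then have "\<forall>\<^sub>F n in sequentially. (1 + real n) powr (1 - 2 * s) > C\<^sup>2 \<and> n > 0"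
      by (intro eventually_conj eventually_gt_at_top) (auto simp: filterlim_at_top_dense)
    then obtain n where "(1 + real n) powr (1 - 2 * s) > C\<^sup>2" "n > 0"
      using eventually_happens'[OF sequentially_bot] by blast
    then show False using bound[of n] by simp
  qed
qed

end
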